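(* Let $\Omega=\{0,1,\dots,2N\}$ and let $A=\tilde{\tau}(\mathbb{R}^{\Omega})\langle x_1,\dots,x_n\rangle$ be a skew PBW extension of $\mathbb{R}^{\Omega}$ with associated automorphisms $\tilde\tau_i$ induced by bijections $\tau_i:\Omega\to\Omega$ and associated $\tilde\tau_i$-derivations $\delta_i$, $1\le i\le n$. Suppose that $\delta_i=0$ for $1\le i\le n$. Then the centralizer $C(\mathbb{R}^{\Omega})$ of $\mathbb{R}^{\Omega}$ in $A$ is $$C(\mathbb{R}^{\Omega})=\left\{\sum_{\alpha}f_{\alpha}x^{\alpha}\in A\ :\ f_{\alpha}=0\text{ on } Sep^{\alpha}(\Omega)\text{ for all }\alpha\in\mathbb{N}^n\right\}.$$
   Context: Here $\mathbb{N}=\{0,1,2,\dots\}$. $\mathbb{R}^{\Omega}$ is the algebra of all functions $f:\Omega\to\mathbb{R}$ with pointwise operations. For $1\le i\le n$, $\tau_i:\Omega\to\Omega$ is a bijection and $\tilde\tau_i:\mathbb{R}^{\Omega}\to\mathbb{R}^{\Omega}$, $\tilde\tau_i(f)=f\circ\tau_i^{-1}$, is the induced automorphism. A skew PBW extension of a ring $R$ is a ring $A\supseteq R$ with elements $x_1,\dots,x_n$ such that: $A$ is a free left $R$-module with basis $\{x^{\alpha}=x_1^{\alpha_1}\cdots x_n^{\alpha_n}:\alpha\in\mathbb{N}^n\}$; for every $i$ and $r\in R\setminus\{0\}$ there is $c_{i,r}\in R\setminus\{0\}$ with $x_ir-c_{i,r}x_i\in R$; and for all $i,j$ there is $c_{i,j}\in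 R\setminus\{0\}$ with $x_jx_i-c_{i,j}x_ix_j\in R+Rx_1+\cdots+Rx_n$. The notation $\tilde{\tau}(\mathbb{R}^{\Omega})\langle x_1,\dots,x_n\rangle$ means such an extension of $R=\mathbb{R}^{\Omega}$ in which $x_ir=\tilde\tau_i(r)x_i+\delta_i(r)$ for all $r\in\mathbb{R}^{\Omega}$, where $\delta_i$ is a $\tilde\tau_i$-derivation of $\mathbb{R}^\Omega$. Every element of $A$ is uniquely a finite sum $\sum_\alpha f_\alpha x^\alpha$ with $f_\alpha\in\mathbb{R}^\Omega$. For $\alpha=(\alpha_1,\dots,\alpha_n)\in\mathbb{N}^n$, $\tau^{\alpha}=\tau_1^{\alpha_1}\cdots\tau_n^{\alpha_n}$ (composition) and $Sep^{\alpha}(\Omega)=\{\omega\in\Omega:\tau^{\alpha}(\omega)\ne\omega\}$. The centralizer is $C(\mathbb{R}^{\Omega})=\{f\in A: fr=rf\ \text{for all } r\in \mathbb{R}^{\Omega}\}$. *)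

theory Defs
  imports Complex_Main "HOL-Algebra.RingHom" "HOL-Library.FuncSet"
begin

text \<open>A ring extension \<open>R \<subseteq> A\<close> is rendered by an injective unital ring homomorphism
  \<open>\<iota>\<close> from \<open>R\<close> to \<open>A\<close>; thus \<open>R\<close> inside \<open>A\<close> is \<open>\<iota> ` carrier R\<close>, and
  \<open>A\<close> is a left \<open>R\<close>-module via \<open>\<iota> r \<otimes>\<^bsub>A\<^esub> a\<close>.\<close>

definition fin_families :: "('r, 's) ring_scheme \<Rightarrow> 'i set \<Rightarrow> ('i \<Rightarrow> 'r) set" where
  "fin_families R I = {c \<in> I \<rightarrow> carrier R. finite {i \<in> I. c i \<noteq> \<zero>\<^bsub>R\<^esub>}}"

text \<open>The sum ranges over the support only, since \<^const>\<open>finsum\<close> is trivial on infinite sets.\<close>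

definition lin_comb ::
  "('r, 's) ring_scheme \<Rightarrow> ('a, 'b) ring_scheme \<Rightarrow> ('r \<Rightarrow> 'a) \<Rightarrow> 'i set \<Rightarrow> ('i \<Rightarrow> 'a) \<Rightarrow> ('i \<Rightarrow> 'r) \<Rightarrow> 'a"
  where "lin_comb R A \<iota> I b c = (\<Oplus>\<^bsub>A\<^esub>i\<in>{i \<in> I. c i \<noteq> \<zero>\<^bsub>R\<^esub>}. \<iota> (c i) \<otimes>\<^bsub>A\<^esub> b i)"

definition free_left_basis ::
  "('r, 's) ring_scheme \<Rightarrow> ('a, 'b) ring_scheme \<Rightarrow> ('r \<Rightarrow> 'a) \<Rightarrow> 'i set \<Rightarrow> ('i \<Rightarrow> 'a) \<Rightarrow> bool"
  where "free_left_basis R A \<iota> I b \<longleftrightarrow>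
    b \<in> I \<rightarrow> carrier A \<and>
    (\<forall>a\<in>carrier A. \<exists>c\<in>fin_families R I. a = lin_comb R A \<iota> I b c) \<and>
    (\<forall>c\<in>fin_families R I. lin_comb R A \<iota> I b c = \<zero>\<^bsub>A\<^esub> \<longrightarrow> (\<forall>i\<in>I. c i = \<zero>\<^bsub>R\<^esub>))"

definition multi_indices :: "nat \<Rightarrow> (nat \<Rightarrow> nat) set" where
  "multi_indices n = {1..n} \<rightarrow>\<^sub>E UNIV"

text \<open>The variables need not commute: the factors occur in increasing order of their index.\<close>

definition std_monom :: "('a, 'b) ring_scheme \<Rightarrow> nat \<Rightarrow> (nat \<Rightarrow> 'a) \<Rightarrow> (nat \<Rightarrow> nat) \<Rightarrow> 'a" where
  "std_monom A n x \<alpha> = foldr (\<lambda>i p. (x i [^]\<^bsub>A\<^esub> \<alpha> i) \<otimes>\<^bsub>A\<^esub> p) [1..<Suc n] \<one>\<^bsub>A\<^esub>"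

text \<open>The left submodule \<open>R + R x\<^sub>1 + \<dots> + R x\<^sub>n\<close>.\<close>

definition deg_le_1 ::
  "('r, 's) ring_scheme \<Rightarrow> ('a, 'b) ring_scheme \<Rightarrow> ('r \<Rightarrow> 'a) \<Rightarrow> nat \<Rightarrow> (nat \<Rightarrow> 'a) \<Rightarrow> 'a set"
  where "deg_le_1 R A \<iota> n x =
    {\<iota> r \<oplus>\<^bsub>A\<^esub> (\<Oplus>\<^bsub>A\<^esub>i\<in>{1..n}. \<iota> (s i) \<otimes>\<^bsub>A\<^esub> x i) | r s. r \<in> carrier R \<and> s \<in> {1..n} \<rightarrow> carrier R}"

locale skew_PBW_extension = ring_hom_ring R A \<iota>
  for R :: "('r, 's) ring_scheme" and A :: "('a, 'b) ring_scheme" and \<iota> :: "'r \<Rightarrow> 'a" +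
  fixes n :: nat and x :: "nat \<Rightarrow> 'a"
  assumes embedding: "inj_on \<iota> (carrier R)"
    and vars_closed: "x \<in> {1..n} \<rightarrow> carrier A"
    and monomial_basis: "free_left_basis R A \<iota> (multi_indices n) (std_monom A n x)"
    and var_coeff: "\<lbrakk>i \<in> {1..n}; r \<in> carrier R - {\<zero>\<^bsub>R\<^esub>}\<rbrakk> \<Longrightarrow>
      \<exists>c\<in>carrier R - {\<zero>\<^bsub>R\<^esub>}. x i \<otimes>\<^bsub>A\<^esub> \<iota> r \<ominus>\<^bsub>A\<^esub> \<iota> c \<otimes>\<^bsub>A\<^esub> x i \<in> \<iota> ` carrier R"
    and var_var: "\<lbrakk>i \<in> {1..n}; j \<in> {1..n}\<rbrakk> \<Longrightarrow>
      \<exists>c\<in>carrier R - {\<zero>\<^bsub>R\<^esub>}.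
        x j \<otimes>\<^bsub>A\<^esub> x i \<ominus>\<^bsub>A\<^esub> \<iota> c \<otimes>\<^bsub>A\<^esub> x i \<otimes>\<^bsub>A\<^esub> x j \<in> deg_le_1 R A \<iota> n x"

definition skew_derivation :: "('r, 's) ring_scheme \<Rightarrow> ('r \<Rightarrow> 'r) \<Rightarrow> ('r \<Rightarrow> 'r) \<Rightarrow> bool" where
  "skew_derivation R \<sigma> \<delta> \<longleftrightarrow>
    \<delta> \<in> carrier R \<rightarrow> carrier R \<and>
    (\<forall>r\<in>carrier R. \<forall>s\<in>carrier R.
      \<delta> (r \<oplus>\<^bsub>R\<^esub> s) = \<delta> r \<oplus>\<^bsub>R\<^esub> \<delta> s \<and>
      \<delta> (r \<otimes>\<^bsub>R\<^esub> s) = \<sigma> r \<otimes>\<^bsub>R\<^esub> \<delta> s \<oplus>\<^bsub>R\<^esub> \<delta> r \<otimes>\<^bsub>R\<^esub> s)"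

definition fun_ring :: "'w set \<Rightarrow> ('w \<Rightarrow> real) ring" where
  "fun_ring \<Omega> =
    \<lparr>carrier = \<Omega> \<rightarrow>\<^sub>E UNIV,
     mult = (\<lambda>f g. \<lambda>\<omega>\<in>\<Omega>. f \<omega> * g \<omega>),
     one = (\<lambda>\<omega>\<in>\<Omega>. 1),
     zero = (\<lambda>\<omega>\<in>\<Omega>. 0),
     add = (\<lambda>f g. \<lambda>\<omega>\<in>\<Omega>. f \<omega> + g \<omega>)\<rparr>"

lemma ring_fun_ring: "ring (fun_ring \<Omega>)"
proof (rule ringI)
  show "abelian_group (fun_ring \<Omega>)"
  proof (rule abelian_groupI)
    fix f assume f: "f \<in> carrier (fun_ring \<Omega>)"
    then show "\<exists>g\<in>carrier (fun_ring \<Omega>). g \<oplus>\<^bsub>fun_ring \<Omega>\<^esub> f = \<zero>\<^bsub>fun_ring \<Omega>\<^esub>"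
      by (intro bexI[of _ "\<lambda>\<omega>\<in>\<Omega>. - f \<omega>"]) (auto simp: fun_ring_def fun_eq_iff)
  qed (auto simp: fun_ring_def fun_eq_iff PiE_iff extensional_def)
  show "monoid (fun_ring \<Omega>)"
    by (rule monoidI) (auto simp: fun_ring_def fun_eq_iff PiE_iff extensional_def)
qed (auto simp: fun_ring_def fun_eq_iff algebra_simps)

definition induced_map :: "'w set \<Rightarrow> ('w \<Rightarrow> 'w) \<Rightarrow> ('w \<Rightarrow> real) \<Rightarrow> ('w \<Rightarrow> real)" where
  "induced_map \<Omega> \<tau> f = restrict (f \<circ> inv_into \<Omega> \<tau>) \<Omega>"

locale fun_skew_PBW_extension = skew_PBW_extension "fun_ring \<Omega>" A \<iota> n x
  for \<Omega> :: "'w set" and A :: "('a, 'b) ring_scheme" and \<iota> n x +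
  fixes \<tau> :: "nat \<Rightarrow> 'w \<Rightarrow> 'w" and \<delta> :: "nat \<Rightarrow> ('w \<Rightarrow> real) \<Rightarrow> ('w \<Rightarrow> real)"
  assumes bijection: "i \<in> {1..n} \<Longrightarrow> bij_betw (\<tau> i) \<Omega> \<Omega>"
    and derivation: "i \<in> {1..n} \<Longrightarrow> skew_derivation (fun_ring \<Omega>) (induced_map \<Omega> (\<tau> i)) (\<delta> i)"
    and commutation: "\<lbrakk>i \<in> {1..n}; r \<in> carrier (fun_ring \<Omega>)\<rbrakk> \<Longrightarrow>
      x i \<otimes>\<^bsub>A\<^esub> \<iota> r = \<iota> (induced_map \<Omega> (\<tau> i) r) \<otimes>\<^bsub>A\<^esub> x i \<oplus>\<^bsub>A\<^esub> \<iota> (\<delta> i r)"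

definition multi_compose :: "nat \<Rightarrow> (nat \<Rightarrow> 'w \<Rightarrow> 'w) \<Rightarrow> (nat \<Rightarrow> nat) \<Rightarrow> 'w \<Rightarrow> 'w" where
  "multi_compose n \<tau> \<alpha> = foldr (\<lambda>i g. (\<tau> i ^^ \<alpha> i) \<circ> g) [1..<Suc n] id"

definition Sep :: "nat \<Rightarrow> (nat \<Rightarrow> 'w \<Rightarrow> 'w) \<Rightarrow> 'w set \<Rightarrow> (nat \<Rightarrow> nat) \<Rightarrow> 'w set" where
  "Sep n \<tau> \<Omega> \<alpha> = {\<omega> \<in> \<Omega>. multi_compose n \<tau> \<alpha> \<omega> \<noteq> \<omega>}"

definition centralizer :: "('a, 'b) ring_scheme \<Rightarrow> 'a set \<Rightarrow> 'a set" where
  "centralizer A S = {a \<in> carrier A. \<forall>s\<in>S. a \<otimes>\<^bsub>A\<^esub> s = s \<otimes>\<^bsub>A\<^esub> a}"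

end

theory Submission
  imports Defs
begin

text \<open>With \<open>\<delta>\<^sub>i = 0\<close> the commutation rule iterates to \<open>x\<^sup>\<alpha> r = (r \<circ> (\<tau>\<^sup>\<alpha>)\<^sup>-\<^sup>1) x\<^sup>\<alpha>\<close>. Comparing the
  coefficients of \<open>f r\<close> and \<open>r f\<close> in the monomial basis, \<open>f\<close> centralizes \<open>R\<close> if and only if
  \<open>f\<^sub>\<alpha> \<cdot> (r \<circ> (\<tau>\<^sup>\<alpha>)\<^sup>-\<^sup>1 - r) = 0\<close> for all \<open>\<alpha>\<close> and \<open>r\<close>. Taking for \<open>r\<close> the indicator function of a
  point \<open>\<omega>\<close> moved by \<open>\<tau>\<^sup>\<alpha>\<close> forces \<open>f\<^sub>\<alpha> \<omega> = 0\<close>.\<close>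

section \<open>Linear combinations with coefficients acting through a ring homomorphism\<close>

lemma fin_familiesD:
  assumes "c \<in> fin_families R I"
  shows "i \<in> I \<Longrightarrow> c i \<in> carrier R" "finite {i \<in> I. c i \<noteq> \<zero>\<^bsub>R\<^esub>}"
  using assms by (auto simp: fin_families_def)

context ring_hom_ring
begin

text \<open>The support varies with the family, so two families can be compared termwise only over a
  common finite index set \<open>J\<close>. The terms added outside the support vanish because
  \<open>h\<close> maps zero to zero.\<close>

lemma lin_comb_eq_finsum:
  assumes "finite J" "{i \<in> I. c i \<noteq> \<zero>} \<subseteq> J" "J \<subseteq> I"
    and "c \<in> I \<rightarrow> carrier R" "b \<in> I \<rightarrow> carrier S"
  shows "lin_comb R S h I b c = (\<Oplus>\<^bsub>S\<^esub>i\<in>J. h (c i) \<otimes>\<^bsub>S\<^esub> b i)"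
  unfolding lin_comb_def
proof (rule S.add.finprod_mono_neutral_cong_left)
  show "(\<lambda>i. h (c i) \<otimes>\<^bsub>S\<^esub> b i) \<in> J \<rightarrow> carrier S"
    using assms by (auto simp: Pi_iff subset_iff)
  show "h (c i) \<otimes>\<^bsub>S\<^esub> b i = \<zero>\<^bsub>S\<^esub>" if "i \<in> J - {i \<in> I. c i \<noteq> \<zero>}" for i
  proof -
    have "c i = \<zero>" "b i \<in> carrier S"
      using that assms by auto
    then show ?thesis
      by simp
  qed
qed (use assms in auto)

lemma lin_comb_closed:
  assumes "c \<in> fin_families R I" "b \<in> I \<rightarrow> carrier S"
  shows "lin_comb R S h I b c \<in> carrier S"
  unfolding lin_comb_def using assms fin_familiesD(1)[OF assms(1)]
  by (intro S.add.finprod_closed) auto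

text \<open>Both combinations are expanded over the union of the two supports. The additive form of
  the identity avoids subtraction in \<open>S\<close>.\<close>

lemma lin_comb_diff:
  assumes c: "c \<in> fin_families R I" and d: "d \<in> fin_families R I" and b: "b \<in> I \<rightarrow> carrier S"
  shows "(\<lambda>i. c i \<ominus> d i) \<in> fin_families R I"
    and "lin_comb R S h I b (\<lambda>i. c i \<ominus> d i) \<oplus>\<^bsub>S\<^esub> lin_comb R S h I b d = lin_comb R S h I b c"
proof -
  let ?J = "{i \<in> I. c i \<noteq> \<zero>} \<union> {i \<in> I. d i \<noteq> \<zero>}"
  have J: "finite ?J" "{i \<in> I. c i \<ominus> d i \<noteq> \<zero>} \<subseteq> ?J"
    using fin_familiesD(2)[OF c] fin_familiesD(2)[OF d] by (auto simp: R.minus_eq)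
  have cd: "c i \<in> carrier R" "d i \<in> carrier R" "b i \<in> carrier S" if "i \<in> I" for i
    using that fin_familiesD(1)[OF c] fin_familiesD(1)[OF d] b by auto
  show "(\<lambda>i. c i \<ominus> d i) \<in> fin_families R I"
    using cd finite_subset[OF J(2,1)] by (auto simp: fin_families_def)
  have "lin_comb R S h I b (\<lambda>i. c i \<ominus> d i) \<oplus>\<^bsub>S\<^esub> lin_comb R S h I b d =
      (\<Oplus>\<^bsub>S\<^esub>i\<in>?J. h (c i \<ominus> d i) \<otimes>\<^bsub>S\<^esub> b i) \<oplus>\<^bsub>S\<^esub> (\<Oplus>\<^bsub>S\<^esub>i\<in>?J. h (d i) \<otimes>\<^bsub>S\<^esub> b i)"
    using J cd by (intro arg_cong2[of _ _ _ _ "add S"] lin_comb_eq_finsum) auto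
  also have "\<dots> = (\<Oplus>\<^bsub>S\<^esub>i\<in>?J. h (c i \<ominus> d i) \<otimes>\<^bsub>S\<^esub> b i \<oplus>\<^bsub>S\<^esub> h (d i) \<otimes>\<^bsub>S\<^esub> b i)"
    using cd by (intro S.finsum_addf[symmetric]) (auto simp: Pi_iff)
  also have "\<dots> = (\<Oplus>\<^bsub>S\<^esub>i\<in>?J. h (c i) \<otimes>\<^bsub>S\<^esub> b i)"
  proof (rule S.finsum_cong')
    fix i assume "i \<in> ?J"
    then have i: "c i \<in> carrier R" "d i \<in> carrier R" "b i \<in> carrier S"
      using cd by auto
    then have "h (c i \<ominus> d i) \<otimes>\<^bsub>S\<^esub> b i \<oplus>\<^bsub>S\<^esub> h (d i) \<otimes>\<^bsub>S\<^esub> b i = h ((c i \<ominus> d i) \<oplus> d i) \<otimes>\<^bsub>S\<^esub> b i"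
      by (simp add: S.l_distr)
    also have "(c i \<ominus> d i) \<oplus> d i = c i"
      using i by (simp add: R.minus_eq R.a_assoc R.l_neg)
    finally show "h (c i \<ominus> d i) \<otimes>\<^bsub>S\<^esub> b i \<oplus>\<^bsub>S\<^esub> h (d i) \<otimes>\<^bsub>S\<^esub> b i = h (c i) \<otimes>\<^bsub>S\<^esub> b i" .
  qed (use cd in auto)
  also have "\<dots> = lin_comb R S h I b c"
    using J cd by (intro lin_comb_eq_finsum[symmetric]) auto
  finally show "lin_comb R S h I b (\<lambda>i. c i \<ominus> d i) \<oplus>\<^bsub>S\<^esub> lin_comb R S h I b d = lin_comb R S h I b c" .
qed

text \<open>Freeness speaks only of combinations equal to zero; applied to the family of differences
  it yields uniqueness of coefficients.\<close>

lemma lin_comb_eq_iff: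
  assumes basis: "free_left_basis R S h I b"
    and c: "c \<in> fin_families R I" and d: "d \<in> fin_families R I"
  shows "lin_comb R S h I b c = lin_comb R S h I b d \<longleftrightarrow> (\<forall>i\<in>I. c i = d i)"
proof
  have b: "b \<in> I \<rightarrow> carrier S"
    using basis by (simp add: free_left_basis_def)
  note diff = lin_comb_diff[OF c d b]
  assume "lin_comb R S h I b c = lin_comb R S h I b d"
  \<comment> \<open>By \<open>diff(2)\<close> this combination \<open>u\<close> satisfies
    \<open>u + v = v\<close>, where \<open>v\<close> is the combination with coefficients
    \<open>d\<close>; cancel \<open>v\<close>.\<close>
  then have "lin_comb R S h I b (\<lambda>i. c i \<ominus> d i) = \<zero>\<^bsub>S\<^esub>"
    using diff lin_comb_closed[OF diff(1) b] lin_comb_closed[OF d b] by (metis S.add.r_cancel_one')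
  then have "\<forall>i\<in>I. c i \<ominus> d i = \<zero>"
    using diff(1) basis by (simp add: free_left_basis_def)
  then show "\<forall>i\<in>I. c i = d i"
    using fin_familiesD(1)[OF c] fin_familiesD(1)[OF d]
    by (metis R.minus_eq R.minus_equality R.minus_minus R.a_inv_closed)
next
  assume "\<forall>i\<in>I. c i = d i"
  then show "lin_comb R S h I b c = lin_comb R S h I b d"
    unfolding lin_comb_def using fin_familiesD(1)[OF c] basis
    by (intro S.finsum_cong') (auto simp: free_left_basis_def Pi_iff)
qed

lemma lin_comb_mult_left:
  assumes c: "c \<in> fin_families R I" and b: "b \<in> I \<rightarrow> carrier S" and r: "r \<in> carrier R"
  shows "(\<lambda>i. r \<otimes> c i) \<in> fin_families R I"
    and "h r \<otimes>\<^bsub>S\<^esub> lin_comb R S h I b c = lin_comb R S h I b (\<lambda>i. r \<otimes> c i)"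
proof -
  let ?J = "{i \<in> I. c i \<noteq> \<zero>}"
  \<comment> \<open>Zero divisors in \<open>R\<close> can shrink the support, so only an inclusion
    holds; the sum is still taken over the old support.\<close>
  have J: "finite ?J" "{i \<in> I. r \<otimes> c i \<noteq> \<zero>} \<subseteq> ?J"
    using fin_familiesD(2)[OF c] r by auto
  have cb: "c i \<in> carrier R" "b i \<in> carrier S" if "i \<in> I" for i
    using that fin_familiesD(1)[OF c] b by auto
  show "(\<lambda>i. r \<otimes> c i) \<in> fin_families R I"
    using cb r finite_subset[OF J(2,1)] by (auto simp: fin_families_def)
  have "h r \<otimes>\<^bsub>S\<^esub> lin_comb R S h I b c = (\<Oplus>\<^bsub>S\<^esub>i\<in>?J. h r \<otimes>\<^bsub>S\<^esub> (h (c i) \<otimes>\<^bsub>S\<^esub> b i))"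
    unfolding lin_comb_def using J cb r by (intro S.finsum_rdistr) auto
  also have "\<dots> = (\<Oplus>\<^bsub>S\<^esub>i\<in>?J. h (r \<otimes> c i) \<otimes>\<^bsub>S\<^esub> b i)"
    using cb r by (intro S.finsum_cong') (auto simp: S.m_assoc)
  also have "\<dots> = lin_comb R S h I b (\<lambda>i. r \<otimes> c i)"
    using J cb r by (intro lin_comb_eq_finsum[symmetric]) auto
  finally show "h r \<otimes>\<^bsub>S\<^esub> lin_comb R S h I b c = lin_comb R S h I b (\<lambda>i. r \<otimes> c i)" .
qed

text \<open>Moving \<open>h r\<close> leftwards past \<open>b i\<close> turns it into the twisted
  coefficient \<open>t i\<close>, which then merges with \<open>c i\<close>. For monomials,
  \<open>t\<close> will be the automorphism belonging to the exponent, applied to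
  \<open>r\<close>.\<close>

lemma lin_comb_mult_right:
  assumes c: "c \<in> fin_families R I" and b: "b \<in> I \<rightarrow> carrier S" and r: "r \<in> carrier R"
    and t: "t \<in> I \<rightarrow> carrier R"
    and swap: "\<And>i. i \<in> I \<Longrightarrow> b i \<otimes>\<^bsub>S\<^esub> h r = h (t i) \<otimes>\<^bsub>S\<^esub> b i"
  shows "(\<lambda>i. c i \<otimes> t i) \<in> fin_families R I"
    and "lin_comb R S h I b c \<otimes>\<^bsub>S\<^esub> h r = lin_comb R S h I b (\<lambda>i. c i \<otimes> t i)"
proof -
  let ?J = "{i \<in> I. c i \<noteq> \<zero>}"
  have cb: "c i \<in> carrier R" "b i \<in> carrier S" "t i \<in> carrier R" if "i \<in> I" for i
    using that fin_familiesD(1)[OF c] b t by auto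
  have J: "finite ?J" "{i \<in> I. c i \<otimes> t i \<noteq> \<zero>} \<subseteq> ?J"
    using fin_familiesD(2)[OF c] cb by auto
  show "(\<lambda>i. c i \<otimes> t i) \<in> fin_families R I"
    using cb finite_subset[OF J(2,1)] by (auto simp: fin_families_def)
  have "lin_comb R S h I b c \<otimes>\<^bsub>S\<^esub> h r = (\<Oplus>\<^bsub>S\<^esub>i\<in>?J. (h (c i) \<otimes>\<^bsub>S\<^esub> b i) \<otimes>\<^bsub>S\<^esub> h r)"
    unfolding lin_comb_def using J cb r by (intro S.finsum_ldistr) auto
  also have "\<dots> = (\<Oplus>\<^bsub>S\<^esub>i\<in>?J. h (c i \<otimes> t i) \<otimes>\<^bsub>S\<^esub> b i)"
  proof (rule S.finsum_cong')
    fix i assume "i \<in> ?J"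
    then have i: "i \<in> I" by simp
    then show "(h (c i) \<otimes>\<^bsub>S\<^esub> b i) \<otimes>\<^bsub>S\<^esub> h r = h (c i \<otimes> t i) \<otimes>\<^bsub>S\<^esub> b i"
      using cb[OF i] r swap[OF i] by (simp add: S.m_assoc)
  qed (use cb in auto)
  also have "\<dots> = lin_comb R S h I b (\<lambda>i. c i \<otimes> t i)"
    using J cb by (intro lin_comb_eq_finsum[symmetric]) auto
  finally show "lin_comb R S h I b c \<otimes>\<^bsub>S\<^esub> h r = lin_comb R S h I b (\<lambda>i. c i \<otimes> t i)" .
qed

end

section \<open>Automorphisms of the function ring induced by bijections\<close>

lemma induced_map_closed [simp]: "induced_map \<Omega> f r \<in> carrier (fun_ring \<Omega>)"
  by (simp add: induced_map_def fun_ring_def)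

lemma induced_map_id:
  assumes "r \<in> carrier (fun_ring \<Omega>)"
  shows "induced_map \<Omega> id r = r"
proof
  fix \<omega>
  have "inv_into \<Omega> id \<omega> = \<omega>" if "\<omega> \<in> \<Omega>"
    using inv_into_f_f[of id \<Omega> \<omega>] that by simp
  then show "induced_map \<Omega> id r \<omega> = r \<omega>"
    using assms by (auto simp: induced_map_def fun_ring_def PiE_iff extensional_def)
qed

text \<open>Inversion reverses the order of composition and precomposition reverses it again, so the
  assignment is covariant.\<close>

lemma induced_map_comp:
  assumes f: "bij_betw f \<Omega> \<Omega>" and g: "bij_betw g \<Omega> \<Omega>"
  shows "induced_map \<Omega> (f \<circ> g) r = induced_map \<Omega> f (induced_map \<Omega> g r)"
proof
  fix \<omega>
  \<comment> \<open>The second fact is needed because \<open>induced_map \<Omega> g r\<close> is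
    restricted to \<open>\<Omega>\<close> and gets evaluated at
    \<open>inv_into \<Omega> f \<omega>\<close>.\<close>
  have "inv_into \<Omega> (f \<circ> g) \<omega> = inv_into \<Omega> g (inv_into \<Omega> f \<omega>)" "inv_into \<Omega> f \<omega> \<in> \<Omega>"
    if "\<omega> \<in> \<Omega>"
    using that f g inv_into_comp[of f g \<Omega> \<omega>] by (auto simp: bij_betw_def inv_into_into)
  then show "induced_map \<Omega> (f \<circ> g) r \<omega> = induced_map \<Omega> f (induced_map \<Omega> g r) \<omega>"
    by (simp add: induced_map_def)
qed

lemma bij_betw_foldr_funpow:
  assumes "\<And>i. i \<in> set is \<Longrightarrow> bij_betw (\<tau> i) \<Omega> \<Omega>"
  shows "bij_betw (foldr (\<lambda>i g. (\<tau> i ^^ \<alpha> i) \<circ> g) is id) \<Omega> \<Omega>"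
  using assms
  by (induction "is") (auto intro!: bij_betw_trans bij_betw_funpow)

text \<open>At a point \<open>\<omega>\<close> the equation reads \<open>c \<omega> * r (inv_into
  \<Omega> s \<omega>) = r \<omega> * c \<omega>\<close>. A suitable \<open>r\<close> separates
  \<open>\<omega>\<close> from its preimage exactly when \<open>s\<close> moves
  \<open>\<omega>\<close>.\<close>

lemma mult_induced_map_eq_iff:
  assumes s: "bij_betw s \<Omega> \<Omega>"
  shows "(\<forall>r\<in>carrier (fun_ring \<Omega>). c \<otimes>\<^bsub>fun_ring \<Omega>\<^esub> induced_map \<Omega> s r = r \<otimes>\<^bsub>fun_ring \<Omega>\<^esub> c) \<longleftrightarrow>
    (\<forall>\<omega>\<in>\<Omega>. s \<omega> \<noteq> \<omega> \<longrightarrow> c \<omega> = 0)"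
proof (intro iffI ballI impI)
  fix \<omega>
  assume *: "\<forall>r\<in>carrier (fun_ring \<Omega>). c \<otimes>\<^bsub>fun_ring \<Omega>\<^esub> induced_map \<Omega> s r = r \<otimes>\<^bsub>fun_ring \<Omega>\<^esub> c"
    and \<omega>: "\<omega> \<in> \<Omega>" "s \<omega> \<noteq> \<omega>"
  \<comment> \<open>The indicator of \<open>\<omega>\<close> is 0 at the preimage of
    \<open>\<omega>\<close> and 1 at \<open>\<omega>\<close>, so evaluation at
    \<open>\<omega>\<close> gives \<open>0 = c \<omega>\<close>.\<close>
  define r :: "'a \<Rightarrow> real" where "r = (\<lambda>\<eta>\<in>\<Omega>. if \<eta> = \<omega> then 1 else 0)"
  have "inv_into \<Omega> s \<omega> \<in> \<Omega>" "s (inv_into \<Omega> s \<omega>) = \<omega>"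
    using s \<omega> by (auto simp: bij_betw_def inv_into_into f_inv_into_f)
  moreover from this have "inv_into \<Omega> s \<omega> \<noteq> \<omega>"
    using \<omega> by auto
  moreover have "(c \<otimes>\<^bsub>fun_ring \<Omega>\<^esub> induced_map \<Omega> s r) \<omega> = (r \<otimes>\<^bsub>fun_ring \<Omega>\<^esub> c) \<omega>"
    using * by (simp add: r_def fun_ring_def)
  ultimately show "c \<omega> = 0"
    using \<omega> by (simp add: fun_ring_def induced_map_def r_def)
next
  fix r
  assume *: "\<forall>\<omega>\<in>\<Omega>. s \<omega> \<noteq> \<omega> \<longrightarrow> c \<omega> = 0"
  \<comment> \<open>At a fixed point of \<open>s\<close> the inverse fixes \<open>\<omega>\<close>
    too and the reals commute; at any other point both sides contain the factor
    \<open>c \<omega> = 0\<close>.\<close>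
  have "c \<omega> * r (inv_into \<Omega> s \<omega>) = r \<omega> * c \<omega>" if "\<omega> \<in> \<Omega>" for \<omega>
  proof (cases "s \<omega> = \<omega>")
    case True
    then have "inv_into \<Omega> s \<omega> = \<omega>"
      using s that by (metis bij_betw_inv_into_left)
    then show ?thesis by simp
  qed (use * that in simp)
  then show "c \<otimes>\<^bsub>fun_ring \<Omega>\<^esub> induced_map \<Omega> s r = r \<otimes>\<^bsub>fun_ring \<Omega>\<^esub> c"
    by (auto simp: fun_ring_def induced_map_def fun_eq_iff)
qed

section \<open>Moving coefficients past monomials when the derivations vanish\<close>

locale fun_skew_PBW_extension_zero_derivation = fun_skew_PBW_extension +
  assumes zero_derivation:
    "\<lbrakk>i \<in> {1..n}; r \<in> carrier (fun_ring \<Omega>)\<rbrakk> \<Longrightarrow> \<delta> i r = \<zero>\<^bsub>fun_ring \<Omega>\<^esub>"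
begin

lemma var_commutation:
  assumes "i \<in> {1..n}" "r \<in> carrier (fun_ring \<Omega>)"
  shows "x i \<otimes>\<^bsub>A\<^esub> \<iota> r = \<iota> (induced_map \<Omega> (\<tau> i) r) \<otimes>\<^bsub>A\<^esub> x i"
  using commutation[OF assms] zero_derivation[OF assms] vars_closed assms(1)
  by (simp add: Pi_iff)

lemma var_power_commutation:
  assumes i: "i \<in> {1..n}" and r: "r \<in> carrier (fun_ring \<Omega>)"
  shows "(x i [^]\<^bsub>A\<^esub> (k::nat)) \<otimes>\<^bsub>A\<^esub> \<iota> r = \<iota> (induced_map \<Omega> (\<tau> i ^^ k) r) \<otimes>\<^bsub>A\<^esub> (x i [^]\<^bsub>A\<^esub> k)"
  using r
\<comment> \<open>The rightmost variable meets \<open>r\<close> first and replaces it by its image,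
  so the induction hypothesis is needed for that image.\<close>
proof (induction k arbitrary: r)
  case 0
  then show ?case
    by (simp add: induced_map_id[unfolded id_def] id_def)
next
  case (Suc k)
  have xi: "x i \<in> carrier A"
    using i vars_closed by auto
  have "x i [^]\<^bsub>A\<^esub> Suc k \<otimes>\<^bsub>A\<^esub> \<iota> r = x i [^]\<^bsub>A\<^esub> k \<otimes>\<^bsub>A\<^esub> \<iota> (induced_map \<Omega> (\<tau> i) r) \<otimes>\<^bsub>A\<^esub> x i"
    using xi Suc.prems i by (simp add: S.m_assoc var_commutation)
  also have "\<dots> = \<iota> (induced_map \<Omega> (\<tau> i ^^ k) (induced_map \<Omega> (\<tau> i) r)) \<otimes>\<^bsub>A\<^esub> x i [^]\<^bsub>A\<^esub> Suc k"
    using xi Suc.IH[of "induced_map \<Omega> (\<tau> i) r"] by (simp add: S.m_assoc)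
  also have "induced_map \<Omega> (\<tau> i ^^ k) (induced_map \<Omega> (\<tau> i) r) = induced_map \<Omega> (\<tau> i ^^ Suc k) r"
    \<comment> \<open>The variable split off was the rightmost one, so the power of
      \<open>\<tau> i\<close> must also be split on the right; the default equations of
      \<open>funpow\<close> split on the left.\<close>
    using induced_map_comp[OF bij_betw_funpow[OF bijection[OF i]] bijection[OF i]]
    by (simp add: funpow_Suc_right del: funpow.simps)
  finally show ?case .
qed

text \<open>An arbitrary list of indices makes induction possible. Closure of \<open>m\<close> is
  carried along because reassociating products requires it. By covariance of
  \<open>induced_map\<close>, the maps compose in the order in which the factors are
  multiplied.\<close>

lemma foldr_monom_commutation:
  fixes \<alpha> :: "nat \<Rightarrow> nat"
  assumes "set is \<subseteq> {1..n}" and r: "r \<in> carrier (fun_ring \<Omega>)"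
  defines "m \<equiv> foldr (\<lambda>i p. (x i [^]\<^bsub>A\<^esub> \<alpha> i) \<otimes>\<^bsub>A\<^esub> p) is \<one>\<^bsub>A\<^esub>"
  shows "m \<in> carrier A \<and>
    m \<otimes>\<^bsub>A\<^esub> \<iota> r = \<iota> (induced_map \<Omega> (foldr (\<lambda>i g. (\<tau> i ^^ \<alpha> i) \<circ> g) is id) r) \<otimes>\<^bsub>A\<^esub> m"
  using assms(1) unfolding m_def
proof (induction "is")
  case Nil
  then show ?case
    using r by (simp add: induced_map_id[unfolded id_def] id_def)
next
  case (Cons i js)
  let ?m = "foldr (\<lambda>i p. (x i [^]\<^bsub>A\<^esub> \<alpha> i) \<otimes>\<^bsub>A\<^esub> p) js \<one>\<^bsub>A\<^esub>"
  let ?g = "foldr (\<lambda>i g. (\<tau> i ^^ \<alpha> i) \<circ> g) js id"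
  have i: "i \<in> {1..n}"
    using Cons.prems by simp
  have xi: "x i [^]\<^bsub>A\<^esub> \<alpha> i \<in> carrier A"
    using i vars_closed by auto
  have m: "?m \<in> carrier A" "?m \<otimes>\<^bsub>A\<^esub> \<iota> r = \<iota> (induced_map \<Omega> ?g r) \<otimes>\<^bsub>A\<^esub> ?m"
    using Cons.IH Cons.prems by (auto simp: comp_def id_def)
  have g: "bij_betw ?g \<Omega> \<Omega>"
    using Cons.prems bijection by (intro bij_betw_foldr_funpow) auto
  have "x i [^]\<^bsub>A\<^esub> \<alpha> i \<otimes>\<^bsub>A\<^esub> ?m \<otimes>\<^bsub>A\<^esub> \<iota> r = x i [^]\<^bsub>A\<^esub> \<alpha> i \<otimes>\<^bsub>A\<^esub> \<iota> (induced_map \<Omega> ?g r) \<otimes>\<^bsub>A\<^esub> ?m"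
    using xi m r by (simp add: S.m_assoc)
  also have "\<dots> = \<iota> (induced_map \<Omega> (\<tau> i ^^ \<alpha> i) (induced_map \<Omega> ?g r)) \<otimes>\<^bsub>A\<^esub> (x i [^]\<^bsub>A\<^esub> \<alpha> i \<otimes>\<^bsub>A\<^esub> ?m)"
    using xi m(1) i by (simp add: var_power_commutation S.m_assoc)
  also have "induced_map \<Omega> (\<tau> i ^^ \<alpha> i) (induced_map \<Omega> ?g r) = induced_map \<Omega> ((\<tau> i ^^ \<alpha> i) \<circ> ?g) r"
    using induced_map_comp[OF bij_betw_funpow[OF bijection[OF i]] g] by simp
  finally show ?case
    using xi m(1) by (simp add: comp_def id_def)
qed

lemma std_monom_commutation:
  assumes "r \<in> carrier (fun_ring \<Omega>)"
  shows "std_monom A n x \<alpha> \<otimes>\<^bsub>A\<^esub> \<iota> r =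
    \<iota> (induced_map \<Omega> (multi_compose n \<tau> \<alpha>) r) \<otimes>\<^bsub>A\<^esub> std_monom A n x \<alpha>"
  using foldr_monom_commutation[of "[1..<Suc n]" r \<alpha>] assms
  by (simp add: std_monom_def multi_compose_def atLeastLessThanSuc_atLeastAtMost del: upt_Suc)

section \<open>The centralizer of the coefficient ring\<close>

lemma bij_betw_multi_compose: "bij_betw (multi_compose n \<tau> \<alpha>) \<Omega> \<Omega>"
  unfolding multi_compose_def using bijection by (intro bij_betw_foldr_funpow) auto

text \<open>For fixed \<open>r\<close>, both products with \<open>\<iota> r\<close> are again
  combinations of monomials, so uniqueness of coefficients reduces commuting to one equation in the
  function ring for each exponent.\<close>

lemma lin_comb_in_centralizer_iff:
  assumes f: "f \<in> fin_families (fun_ring \<Omega>) (multi_indices n)"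
  shows "lin_comb (fun_ring \<Omega>) A \<iota> (multi_indices n) (std_monom A n x) f
      \<in> centralizer A (\<iota> ` carrier (fun_ring \<Omega>)) \<longleftrightarrow>
    (\<forall>\<alpha>\<in>multi_indices n. \<forall>\<omega>\<in>Sep n \<tau> \<Omega> \<alpha>. f \<alpha> \<omega> = 0)"
proof -
  let ?R = "fun_ring \<Omega>"
  let ?lc = "lin_comb ?R A \<iota> (multi_indices n) (std_monom A n x)"
  let ?t = "\<lambda>r \<alpha>. induced_map \<Omega> (multi_compose n \<tau> \<alpha>) r"
  have b: "std_monom A n x \<in> multi_indices n \<rightarrow> carrier A"
    using monomial_basis by (simp add: free_left_basis_def)
  have "?lc f \<otimes>\<^bsub>A\<^esub> \<iota> r = \<iota> r \<otimes>\<^bsub>A\<^esub> ?lc f \<longleftrightarrow>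
      (\<forall>\<alpha>\<in>multi_indices n. f \<alpha> \<otimes>\<^bsub>?R\<^esub> ?t r \<alpha> = r \<otimes>\<^bsub>?R\<^esub> f \<alpha>)"
    if r: "r \<in> carrier ?R" for r
  proof -
    have t: "?t r \<in> multi_indices n \<rightarrow> carrier ?R"
      by simp
    note left = lin_comb_mult_left[OF f b r]
    note right = lin_comb_mult_right[OF f b r t std_monom_commutation[OF r]]
    show ?thesis
      using lin_comb_eq_iff[OF monomial_basis right(1) left(1)] left(2) right(2) by simp
  qed
  \<comment> \<open>Exchanging the quantifiers over \<open>r\<close> and \<open>\<alpha>\<close>
    isolates, for each exponent, the pointwise criterion of
    \<open>mult_induced_map_eq_iff\<close>.\<close>
  then have "?lc f \<in> centralizer A (\<iota> ` carrier ?R) \<longleftrightarrow>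
      (\<forall>\<alpha>\<in>multi_indices n. \<forall>r\<in>carrier ?R. f \<alpha> \<otimes>\<^bsub>?R\<^esub> ?t r \<alpha> = r \<otimes>\<^bsub>?R\<^esub> f \<alpha>)"
    using lin_comb_closed[OF f b] by (auto simp: centralizer_def)
  then show ?thesis
    by (auto simp: mult_induced_map_eq_iff[OF bij_betw_multi_compose] Sep_def)
qed

text \<open>The spanning half of the basis property writes every element of \<open>A\<close> as a
  combination of monomials, to which the membership criterion applies.\<close>

lemma centralizer_eq:
  "centralizer A (\<iota> ` carrier (fun_ring \<Omega>)) =
    {lin_comb (fun_ring \<Omega>) A \<iota> (multi_indices n) (std_monom A n x) f | f.
      f \<in> fin_families (fun_ring \<Omega>) (multi_indices n) \<and>
      (\<forall>\<alpha>\<in>multi_indices n. \<forall>\<omega>\<in>Sep n \<tau> \<Omega> \<alpha>. f \<alpha> \<omega> = 0)}"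
  (is "?C = ?D")
proof
  show "?C \<subseteq> ?D"
  proof
    fix a assume a: "a \<in> ?C"
    then have "a \<in> carrier A"
      by (simp add: centralizer_def)
    then obtain f where "f \<in> fin_families (fun_ring \<Omega>) (multi_indices n)"
      and "a = lin_comb (fun_ring \<Omega>) A \<iota> (multi_indices n) (std_monom A n x) f"
      using monomial_basis unfolding free_left_basis_def by blast
    then show "a \<in> ?D"
      using a lin_comb_in_centralizer_iff by blast
  qed
  show "?D \<subseteq> ?C"
    using lin_comb_in_centralizer_iff by blast
qed

end

theorem theorem3:
  fixes N n :: nat
    and A :: "('a, 'b) ring_scheme"
    and \<iota> :: "(nat \<Rightarrow> real) \<Rightarrow> 'a"
    and x :: "nat \<Rightarrow> 'a"
    and \<tau> :: "nat \<Rightarrow> nat \<Rightarrow> nat"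
    and \<delta> :: "nat \<Rightarrow> (nat \<Rightarrow> real) \<Rightarrow> (nat \<Rightarrow> real)"
    and \<Omega> :: "nat set"
  assumes "\<Omega> = {0..2 * N}"
    and "fun_skew_PBW_extension \<Omega> A \<iota> n x \<tau> \<delta>"
    and "\<And>i r. \<lbrakk>i \<in> {1..n}; r \<in> carrier (fun_ring \<Omega>)\<rbrakk> \<Longrightarrow> \<delta> i r = \<zero>\<^bsub>fun_ring \<Omega>\<^esub>"
  shows "centralizer A (\<iota> ` carrier (fun_ring \<Omega>)) =
    {lin_comb (fun_ring \<Omega>) A \<iota> (multi_indices n) (std_monom A n x) f | f.
      f \<in> fin_families (fun_ring \<Omega>) (multi_indices n) \<and>
      (\<forall>\<alpha>\<in>multi_indices n. \<forall>\<omega>\<in>Sep n \<tau> \<Omega> \<alpha>. f \<alpha> \<omega> = 0)}"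
proof -
  interpret fun_skew_PBW_extension_zero_derivation \<Omega> A \<iota> n x \<tau> \<delta>
    using assms(2,3)
    by (simp add: fun_skew_PBW_extension_zero_derivation_def
        fun_skew_PBW_extension_zero_derivation_axioms_def)
  show ?thesis
    by (rule centralizer_eq)
qed

end
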